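(* Let $l,m,b,c$ be positive integers with $l>2$ and $m>2$. (1) Let $p>2$ and $q$ be two distinct primes such that $p\mid q^{2b}l^2+1$ and $q^{2c+1}\,\|\,(m-1)$. If $q$ is self-conjugate modulo $p$ and $p\nmid (m-2)k$, then a $(q^{2b}l^2+1,m,k,\lambda)$-SEDF does not exist in any abelian group. (2) Let $q$ be a prime such that $q^{2c}\,\|\,(m-1)$ or $q\nmid (m-1)$, and let $p$ be an odd prime such that $p\mid q^{2b+1}l^2+1$. If $q$ is self-conjugate modulo $p$ and $p\nmid (m-2)k$, then a $(q^{2b+1}l^2+1,m,k,\lambda)$-SEDF does not exist in any abelian group.
   Context: Let $G$ be a finite abelian group of order $v$ with identity $e$. A $(v,m,k,\lambda)$-SEDF in $G$ is a collection $\{D_1,\dots,D_m\}$ of pairwise disjoint $k$-subsets of $G$ such that for each $j$ the multiset $\{xy^{-1}: x\in D_\ell,\ y\in D_j,\ \ell\neq j\}$ contains every non-identity element of $G$ exactly $\lambda$ times and does not contain $e$. $q^a\| n$ means $q^a\mid n$ but $q^{a+1}\nmid n$. A prime $q\neq p$ is self-conjugate modulo the prime $p$ if $q^r\equiv -1\pmod p$ for some integer $r$. *)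

theory Defs
  imports "HOL-Number_Theory.Number_Theory" "HOL-Algebra.Coset" "HOL-Library.Multiset"
begin

definition sedf_quotients ::
    "('a, 'b) monoid_scheme \<Rightarrow> nat \<Rightarrow> (nat \<Rightarrow> 'a set) \<Rightarrow> nat \<Rightarrow> 'a multiset" where
  "sedf_quotients G m D j =
     (\<Sum>i\<in>{1..m} - {j}. image_mset (\<lambda>(x, y). x \<otimes>\<^bsub>G\<^esub> inv\<^bsub>G\<^esub> y) (mset_set (D i \<times> D j)))"

text \<open>The sets of an SEDF are given as an indexed family, of which only the values on \<open>{1..m}\<close>
  matter. Neither \<open>k\<close> nor \<open>lam\<close> is required to be positive.\<close>

definition is_SEDF ::
    "('a, 'b) monoid_scheme \<Rightarrow> nat \<Rightarrow> nat \<Rightarrow> nat \<Rightarrow> nat \<Rightarrow> (nat \<Rightarrow> 'a set) \<Rightarrow> bool" where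
  "is_SEDF G v m k lam D \<longleftrightarrow>
     comm_group G \<and> finite (carrier G) \<and> Coset.order G = v \<and>
     (\<forall>j\<in>{1..m}. D j \<subseteq> carrier G \<and> card (D j) = k) \<and>
     (\<forall>i\<in>{1..m}. \<forall>j\<in>{1..m}. i \<noteq> j \<longrightarrow> D i \<inter> D j = {}) \<and>
     (\<forall>j\<in>{1..m}.
        (\<forall>g\<in>carrier G - {\<one>\<^bsub>G\<^esub>}. count (sedf_quotients G m D j) g = lam) \<and>
        \<one>\<^bsub>G\<^esub> \<notin># sedf_quotients G m D j)"

definition exactly_divides :: "nat \<Rightarrow> nat \<Rightarrow> nat \<Rightarrow> bool" where
  "exactly_divides q a n \<longleftrightarrow> q ^ a dvd n \<and> \<not> q ^ (a + 1) dvd n"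

text \<open>Used for distinct primes \<open>q\<close> and \<open>p\<close>. Then \<open>q\<close> is a unit of finite order modulo \<open>p\<close>, so
  natural exponents already give every integer power of \<open>q\<close> modulo \<open>p\<close>.\<close>

definition self_conjugate_mod :: "nat \<Rightarrow> nat \<Rightarrow> bool" where
  "self_conjugate_mod q p \<longleftrightarrow> (\<exists>r::nat. [int q ^ r = - 1] (mod int p))"

end

theory Submission
  imports Defs "HOL-Algebra.Sylow" Jordan_Normal_Form.Char_Poly
begin

text \<open>Let \<open>\<chi>\<close> be a character of order \<open>p\<close> of the group, \<open>X\<^sub>i = \<chi>(D\<^sub>i)\<close> and \<open>S\<close> the sum of the \<open>X\<^sub>i\<close>. Applying \<open>\<chi>\<close> to the
  defining multisets gives \<open>(S - X\<^sub>j) cnj X\<^sub>j = - \<lambda>\<close>. If \<open>S \<noteq> 0\<close>, every \<open>X\<^sub>j / S\<close> is a root of one real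
  quadratic whose roots have sum 1 and negative product; the \<open>X\<^sub>j / S\<close> have sum 1 and so cannot all
  be equal, whence \<open>X\<^sub>i + X\<^sub>j = S\<close> for some \<open>i\<close> and \<open>j\<close>. Modulo the prime above \<open>p\<close> this reads \<open>2k = mk\<close>,
  so \<open>p\<close> divides \<open>(m - 2)k\<close>. If \<open>S = 0\<close>, then \<open>\<bar>X\<^sub>j\<bar>\<^sup>2 = \<lambda>\<close>; as \<open>q\<close> is self-conjugate modulo \<open>p\<close>, the exponent
  of \<open>q\<close> in \<open>\<lambda>\<close> is even, which contradicts \<open>\<lambda>(v - 1) = (m - 1)k\<^sup>2\<close>.\<close>

section \<open>The ring Z[z] and the integrality of its elements\<close>

text \<open>Each element of Z[z] comes with an integer polynomial representing it, and Frobenius is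
  applied to that polynomial.\<close>

definition int_adjoin :: "complex \<Rightarrow> complex set" where
  "int_adjoin z = range (\<lambda>f :: int poly. poly (of_int_poly f) z)"

lemma int_adjoin_poly: "poly (of_int_poly f) z \<in> int_adjoin z"
  by (simp add: int_adjoin_def)

lemma int_adjoinE:
  assumes "y \<in> int_adjoin z"
  obtains f :: "int poly" where "y = poly (of_int_poly f) z"
  using assms by (auto simp: int_adjoin_def)

lemma int_adjoin_of_int: "of_int a \<in> int_adjoin z"
  using int_adjoin_poly[of "[:a:]" z] by (simp add: hom_distribs)

lemma int_adjoin_diff:
  assumes "x \<in> int_adjoin z" "y \<in> int_adjoin z" shows "x - y \<in> int_adjoin z"
proof -
  from assms obtain f g :: "int poly"
    where "x = poly (of_int_poly f) z" "y = poly (of_int_poly g) z"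
    by (auto elim!: int_adjoinE)
  then show ?thesis using int_adjoin_poly[of "f - g" z] by (simp add: hom_distribs)
qed

lemma int_adjoin_add:
  assumes "x \<in> int_adjoin z" "y \<in> int_adjoin z" shows "x + y \<in> int_adjoin z"
proof -
  from assms obtain f g :: "int poly"
    where "x = poly (of_int_poly f) z" "y = poly (of_int_poly g) z"
    by (auto elim!: int_adjoinE)
  then show ?thesis using int_adjoin_poly[of "f + g" z] by (simp add: hom_distribs)
qed

lemma int_adjoin_mult:
  assumes "x \<in> int_adjoin z" "y \<in> int_adjoin z" shows "x * y \<in> int_adjoin z"
proof -
  from assms obtain f g :: "int poly"
    where "x = poly (of_int_poly f) z" "y = poly (of_int_poly g) z"
    by (auto elim!: int_adjoinE)
  then show ?thesis using int_adjoin_poly[of "f * g" z] by (simp add: hom_distribs)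
qed

lemma int_adjoin_power:
  assumes "x \<in> int_adjoin z" shows "x ^ n \<in> int_adjoin z"
  using assms int_adjoin_of_int[of 1 z] by (induction n) (auto intro: int_adjoin_mult)

lemma int_adjoin_gen_power: "z ^ n \<in> int_adjoin z"
  using int_adjoin_poly[of "monom 1 n" z] by (simp add: poly_monom)

text \<open>Horner's scheme: each coefficient costs one multiplication by \<open>z\<close>, which
  permutes the powers of \<open>z\<close> cyclically. Finite generation is what yields integrality
  below.\<close>

lemma int_adjoin_root_of_unity_span:
  assumes "z ^ n = 1" "n > 0" "y \<in> int_adjoin z"
  shows "\<exists>c :: nat \<Rightarrow> int. y = (\<Sum>j<n. of_int (c j) * z ^ j)"
proof -
  obtain k where n: "n = Suc k" using assms(2) by (cases n) auto
  have "\<exists>c :: nat \<Rightarrow> int. poly (of_int_poly f) z = (\<Sum>j<n. of_int (c j) * z ^ j)" for f :: "int poly"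
  proof (induction f)
    case 0
    show ?case by (intro exI[of _ "\<lambda>_. 0"]) simp
  next
    case (pCons a f)
    then obtain c :: "nat \<Rightarrow> int" where c: "poly (of_int_poly f) z = (\<Sum>j<n. of_int (c j) * z ^ j)"
      by blast
    \<comment> \<open>The shift sends the top coefficient \<open>c k\<close> to
      \<open>z ^ n = 1\<close>, so it wraps round to the constant term.\<close>
    define c' where "c' = (\<lambda>j. case j of 0 \<Rightarrow> a + c k | Suc i \<Rightarrow> c i)"
    have "poly (of_int_poly (pCons a f)) z = of_int a + z * (\<Sum>j<n. of_int (c j) * z ^ j)"
      using c by (simp add: hom_distribs)
    also have "z * (\<Sum>j<n. of_int (c j) * z ^ j) = (\<Sum>j<n. of_int (c j) * z ^ Suc j)"
      by (simp add: sum_distrib_left mult_ac)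
    also have "\<dots> = (\<Sum>j<k. of_int (c j) * z ^ Suc j) + of_int (c k) * z ^ n"
      by (simp add: n)
    finally have "poly (of_int_poly (pCons a f)) z
        = of_int (c' 0) + (\<Sum>j<k. of_int (c' (Suc j)) * z ^ Suc j)"
      by (simp add: assms(1) c'_def)
    also have "\<dots> = (\<Sum>j<n. of_int (c' j) * z ^ j)"
      unfolding n by (subst sum.lessThan_Suc_shift) simp
    finally show ?case by blast
  qed
  then show ?thesis using assms(3) by (auto elim!: int_adjoinE)
qed

text \<open>Multiplication by \<open>y\<close> acts on the generators \<open>z ^ j\<close> through an integer matrix, of which
  \<open>y\<close> is therefore an eigenvalue.\<close>
lemma algebraic_int_int_adjoin:
  assumes "z ^ n = 1" "n > 0" "y \<in> int_adjoin z"
  shows "algebraic_int y"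
proof -
  have "\<exists>c :: nat \<Rightarrow> int. y * z ^ i = (\<Sum>j<n. of_int (c j) * z ^ j)" for i
    using assms by (intro int_adjoin_root_of_unity_span int_adjoin_mult int_adjoin_gen_power)
  then obtain c :: "nat \<Rightarrow> nat \<Rightarrow> int" where c: "\<And>i. y * z ^ i = (\<Sum>j<n. of_int (c i j) * z ^ j)"
    by metis
  define A where "A = mat n n (\<lambda>(i, j). c i j)"
  define v where "v = vec n (\<lambda>j. z ^ j)"
  have A: "A \<in> carrier_mat n n" by (simp add: A_def)
  then have A': "of_int_hom.mat_hom A \<in> carrier_mat n n" by simp
  have "of_int_hom.mat_hom A *\<^sub>v v = y \<cdot>\<^sub>v v"
    by (rule eq_vecI) (auto simp: A_def v_def scalar_prod_def c lessThan_atLeast0)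
  moreover have "v \<noteq> 0\<^sub>v n"
  proof
    assume "v = 0\<^sub>v n"
    then have "v $ 0 = 0\<^sub>v n $ 0" by simp
    with assms(2) show False by (simp add: v_def)
  qed
  moreover have "v \<in> carrier_vec n" by (simp add: v_def)
  ultimately have "eigenvalue (of_int_hom.mat_hom A) y"
    using A' by (auto simp: eigenvalue_def eigenvector_def intro!: exI[of _ v])
  then have "poly (of_int_poly (char_poly A)) y = 0"
    using eigenvalue_root_char_poly[OF A'] of_int_hom.char_poly_hom[OF A] by metis
  moreover have "lead_coeff (char_poly A) = 1"
    using degree_monic_char_poly[OF A] by simp
  ultimately show ?thesis by (auto simp: algebraic_int_altdef_ipoly)
qed

section \<open>Frobenius congruences modulo a prime\<close>

text \<open>All inner binomial coefficients are multiples of \<open>q\<close>. The ring is arbitrary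
  so that integer polynomials are covered.\<close>

lemma prime_dvd_add_power_diff:
  fixes x y :: "'a :: comm_ring_1"
  assumes "prime q"
  shows "of_nat q dvd (x + y) ^ q - (x ^ q + y ^ q)"
proof -
  have q: "q > 1" using assms by (rule prime_gt_1_nat)
  have "(x + y) ^ q = (\<Sum>k\<le>q. of_nat (q choose k) * x ^ k * y ^ (q - k))"
    by (rule binomial_ring)
  also have "{..q} = insert 0 (insert q {1..<q})" using q by auto
  also have "(\<Sum>k\<in>insert 0 (insert q {1..<q}). of_nat (q choose k) * x ^ k * y ^ (q - k))
      = y ^ q + x ^ q + (\<Sum>k=1..<q. of_nat (q choose k) * x ^ k * y ^ (q - k))"
    using q by simp
  finally have "(x + y) ^ q - (x ^ q + y ^ q)
      = (\<Sum>k=1..<q. of_nat (q choose k) * x ^ k * y ^ (q - k))" by simp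
  also have "of_nat q dvd \<dots>"
  proof (intro dvd_sum dvd_mult2)
    fix k assume "k \<in> {1..<q}"
    then have "q dvd (q choose k)" using assms by (intro dvd_choose_prime) auto
    then show "of_nat q dvd (of_nat (q choose k) :: 'a)" by (metis dvdE dvd_triv_left of_nat_mult)
  qed
  finally show ?thesis .
qed

lemma prime_dvd_add_prime_power_diff:
  fixes x y :: "'a :: comm_ring_1"
  assumes "prime q"
  shows "of_nat q dvd (x + y) ^ (q ^ s) - (x ^ (q ^ s) + y ^ (q ^ s))"
proof (induction s)
  case (Suc s)
  let ?n = "q ^ s"
  have pow: "w ^ (q ^ Suc s) = (w ^ ?n) ^ q" for w :: 'a
    by (simp add: power_mult[symmetric] mult.commute)
  \<comment> \<open>Congruence survives taking \<open>q\<close>-th powers because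
    \<open>a - b\<close> divides \<open>a ^ q - b ^ q\<close>.\<close>
  have "of_nat q dvd ((x + y) ^ ?n) ^ q - (x ^ ?n + y ^ ?n) ^ q"
    using Suc by (rule dvd_trans) (metis power_diff_sumr2 dvd_triv_left)
  moreover have "of_nat q dvd (x ^ ?n + y ^ ?n) ^ q - ((x ^ ?n) ^ q + (y ^ ?n) ^ q)"
    using assms by (rule prime_dvd_add_power_diff)
  ultimately have "of_nat q dvd (((x + y) ^ ?n) ^ q - (x ^ ?n + y ^ ?n) ^ q)
      + ((x ^ ?n + y ^ ?n) ^ q - ((x ^ ?n) ^ q + (y ^ ?n) ^ q))"
    by (rule dvd_add)
  then show ?case unfolding pow by (simp only: diff_add_cancel add_diff_eq)
qed simp

lemma prime_dvd_power_diff_int: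
  fixes a :: int
  assumes "prime q"
  shows "int q dvd a ^ (q ^ s) - a"
proof (induction s)
  case (Suc s)
  have "int q dvd b ^ q - b" for b :: int
  proof -
    \<comment> \<open>Fermat's theorem is applied to the natural residue of
      \<open>b\<close>.\<close>
    define n where "n = nat (b mod int q)"
    have "[n ^ q = n] (mod q)"
    proof (cases "q dvd n")
      case True
      then have "q dvd n ^ q" using prime_gt_0_nat[OF assms] by (simp add: dvd_power dvd_trans[of q n])
      then show ?thesis using True by (simp add: cong_def)
    next
      case False
      then have "[n ^ (q - 1) * n = 1 * n] (mod q)"
        using assms by (intro cong_mult fermat_theorem cong_refl)
      moreover have "n ^ (q - 1) * n = n ^ q"
        using prime_gt_0_nat[OF assms] by (simp add: power_eq_if[of n q] mult.commute)
      ultimately show ?thesis by simp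
    qed
    then have "[int n ^ q = int n] (mod int q)"
      by (simp flip: cong_int_iff)
    moreover have "[b = int n] (mod int q)"
      using prime_gt_0_nat[OF assms] by (simp add: n_def cong_def)
    ultimately have "[b ^ q = b] (mod int q)"
      by (metis cong_pow cong_sym cong_trans)
    then show ?thesis by (simp add: cong_iff_dvd_diff)
  qed
  then have "int q dvd (a ^ (q ^ s)) ^ q - a ^ (q ^ s)" .
  then have "int q dvd (a ^ (q ^ s)) ^ q - a ^ (q ^ s) + (a ^ (q ^ s) - a)" using Suc by (rule dvd_add)
  then show ?case by (simp add: power_mult[symmetric] mult.commute)
qed simp

text \<open>Split off the constant coefficient: powers are additive modulo \<open>q\<close>, Fermat
  fixes the constant, and induction handles the rest.\<close>

lemma prime_dvd_poly_frobenius: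
  fixes f :: "int poly"
  assumes "prime q"
  shows "of_nat q dvd f ^ (q ^ s) - f \<circ>\<^sub>p monom 1 (q ^ s)"
proof (induction f)
  case 0
  have "q ^ s > 0" using assms prime_gt_0_nat by simp
  then show ?case by (simp add: power_0_left)
next
  case (pCons a f)
  let ?n = "q ^ s" and ?X = "monom (1::int) 1"
  have Xn: "?X ^ ?n = monom 1 ?n" by (simp add: monom_power)
  have 1: "of_nat q dvd (pCons a f) ^ ?n - ([:a:] ^ ?n + (?X * f) ^ ?n)"
  proof -
    have "pCons a f = [:a:] + ?X * f" by (simp add: monom_altdef)
    then show ?thesis using prime_dvd_add_prime_power_diff[OF assms, of "[:a:]" "?X * f" s] by simp
  qed
  have 2: "of_nat q dvd [:a:] ^ ?n - [:a:]"
  proof -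
    obtain t where "a ^ ?n - a = int q * t"
      using prime_dvd_power_diff_int[OF assms] by (blast elim: dvdE)
    then have "[:a:] ^ ?n - [:a:] = of_nat q * [:t:]"
      by (simp add: poly_const_pow of_nat_poly)
    then show ?thesis by (metis dvd_triv_left)
  qed
  have 3: "of_nat q dvd (?X * f) ^ ?n - monom 1 ?n * (f \<circ>\<^sub>p monom 1 ?n)"
    using dvd_mult[OF pCons(2), of "monom 1 ?n"]
    by (simp add: power_mult_distrib Xn[unfolded One_nat_def] right_diff_distrib)
  have "(pCons a f) ^ ?n - pCons a f \<circ>\<^sub>p monom 1 ?n
     = ((pCons a f) ^ ?n - ([:a:] ^ ?n + (?X * f) ^ ?n)) + ([:a:] ^ ?n - [:a:])
       + ((?X * f) ^ ?n - monom 1 ?n * (f \<circ>\<^sub>p monom 1 ?n))"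
    by (simp add: pcompose_pCons)
  then show ?case using 1 2 3 by (metis dvd_add)
qed

text \<open>Divisibility by \<open>q\<close> is trivial in the field of complex numbers, so the
  congruence is proved for polynomials and then evaluated, with the cofactor \<open>w\<close> kept
  inside Z[z].\<close>

lemma int_adjoin_frobenius:
  fixes f :: "int poly"
  assumes "prime q"
  shows "\<exists>w\<in>int_adjoin z. poly (of_int_poly f) z ^ (q ^ s)
    = poly (of_int_poly f) (z ^ (q ^ s)) + of_nat q * w"
proof -
  obtain g where g: "f ^ (q ^ s) - f \<circ>\<^sub>p monom 1 (q ^ s) = of_nat q * g"
    using prime_dvd_poly_frobenius[OF assms] by (blast elim: dvdE)
  then have "f ^ (q ^ s) = f \<circ>\<^sub>p monom 1 (q ^ s) + of_nat q * g" by (simp add: algebra_simps)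
  then have "poly (of_int_poly (f ^ (q ^ s))) z
      = poly (of_int_poly (f \<circ>\<^sub>p monom 1 (q ^ s) + of_nat q * g)) z" by simp
  then have "poly (of_int_poly f) z ^ (q ^ s)
      = poly (of_int_poly f) (z ^ (q ^ s)) + of_nat q * poly (of_int_poly g) z"
    by (simp add: hom_distribs of_int_hom.map_poly_pcompose poly_pcompose poly_monom of_nat_poly)
  then show ?thesis using int_adjoin_poly by blast
qed

section \<open>From divisibility in Z[z] to divisibility in the integers\<close>

text \<open>By Frobenius, \<open>0 = f(z)\<^sup>p\<close> and \<open>f(z\<^sup>p) = f(1)\<close> agree modulo \<open>p\<close>. This replaces the irreducibility
  of the cyclotomic polynomial.\<close>
lemma prime_dvd_poly_1_if_root_of_unity_root:
  fixes f :: "int poly" and z :: complex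
  assumes "prime p" "z ^ p = 1" "poly (of_int_poly f) z = 0"
  shows "int p dvd poly f 1"
proof -
  have p: "p > 0" using assms(1) by (rule prime_gt_0_nat)
  obtain w where w: "w \<in> int_adjoin z"
    "poly (of_int_poly f) z ^ (p ^ 1) = poly (of_int_poly f) (z ^ (p ^ 1)) + of_nat p * w"
    using int_adjoin_frobenius[OF assms(1)] by blast
  have "of_int (poly f 1) = of_nat p * (- w)"
    using w(2) assms(2,3) p by (simp add: of_int_hom.poly_map_poly_1 power_0_left eq_neg_iff_add_eq_0[symmetric])
  \<comment> \<open>This makes \<open>- w\<close> rational; as an element of Z[z] it is also
    integral, hence an integer.\<close>
  then have eq: "- w = of_int (poly f 1) / of_nat p" using p by (simp add: field_simps)
  have "- w \<in> int_adjoin z"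
    using int_adjoin_diff[OF int_adjoin_of_int[of 0] w(1)] by simp
  then have "algebraic_int (- w)" using assms(2) p by (intro algebraic_int_int_adjoin)
  moreover have "- w \<in> \<rat>" unfolding eq by auto
  ultimately have "- w \<in> \<int>" by (rule rational_algebraic_int_is_int)
  then obtain t where "- w = of_int t" by (elim Ints_cases)
  with eq p have "(of_int (poly f 1) :: complex) = of_int (int p * t)" by (simp add: field_simps)
  then have "poly f 1 = int p * t" by (simp only: of_int_eq_iff)
  then show ?thesis by simp
qed

text \<open>Descent. If \<open>q\<close> divides \<open>n\<close>, then \<open>X ^ (q ^ r + 1)\<close> is congruent to \<open>cnj X * X\<close>, hence to 0, modulo \<open>q\<close>. So is
  \<open>X ^ (q ^ (2 * r))\<close>, which is congruent to \<open>X\<close>. Thus \<open>X\<close> can be divided by \<open>q\<close>, and \<open>n\<close> by \<open>q\<^sup>2\<close>.\<close>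
lemma even_multiplicity_norm_self_conjugate:
  assumes "prime q" "p > 2" "self_conjugate_mod q p" "z ^ p = 1" "norm z = 1"
    and "X \<in> int_adjoin z" "X * cnj X = of_nat n" "n > 0"
  shows "even (multiplicity q n)"
  using assms(6-)
proof (induction n arbitrary: X rule: less_induct)
  case (less n)
  have q: "q > 1" using assms(1) by (rule prime_gt_1_nat)
  show ?case
  proof (cases "q dvd n")
    case False
    then show ?thesis by (simp add: not_dvd_imp_multiplicity_0)
  next
    case True
    obtain r where r: "[int q ^ r = - 1] (mod int p)"
      using assms(3) by (auto simp: self_conjugate_mod_def)
    let ?s = "q ^ r"
    have "int p dvd int (?s + 1)" using r by (simp add: cong_iff_dvd_diff add.commute)
    then have "p dvd ?s + 1" by (simp only: int_dvd_int_iff)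
    then obtain t where t: "?s + 1 = p * t" by (auto elim: dvdE)
    then have "z ^ ?s * z = 1"
      using assms(4) by (metis power_add power_mult power_one power_one_right)
    moreover have "cnj z * z = 1" using assms(5)
      by (simp add: complex_norm_square[symmetric] mult.commute)
    moreover have "z \<noteq> 0" using assms(5) by auto
    ultimately have cnj_z: "z ^ ?s = cnj z" by (metis mult_right_cancel)
    have zss: "z ^ (?s * ?s) = z"
      by (metis cnj_z complex_cnj_cnj complex_cnj_power power_mult)
    \<comment> \<open>\<open>?s = 1\<close> would give \<open>p dvd 2\<close>. The bound ensures
      \<open>?s + 1 \<le> ?s * ?s\<close>, so that \<open>X ^ (?s + 1)\<close> divides
      \<open>X ^ (?s * ?s)\<close> in Z[z].\<close>
    have s2: "?s \<ge> 2"
    proof (rule ccontr)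
      assume "\<not> ?s \<ge> 2"
      moreover have "?s > 0" using q by simp
      ultimately have "?s + 1 = 2" by linarith
      then have "p dvd 2" using \<open>p dvd ?s + 1\<close> by metis
      then show False using assms(2) by (auto dest: dvd_imp_le)
    qed
    obtain f :: "int poly" where X: "X = poly (of_int_poly f) z"
      using less.prems(1) by (rule int_adjoinE)
    have cnj_poly: "cnj (poly (of_int_poly h) z) = poly (of_int_poly h) (cnj z)" for h :: "int poly"
      by (induction h) (simp_all add: map_poly_pCons)
    \<comment> \<open>Conjugation is the substitution of \<open>z ^ ?s\<close> for
      \<open>z\<close>.\<close>
    have cnj_closed: "cnj y \<in> int_adjoin z" if "y \<in> int_adjoin z" for y
    proof -
      obtain h :: "int poly" where "y = poly (of_int_poly h) z"
        using \<open>y \<in> int_adjoin z\<close> by (rule int_adjoinE)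
      then have "cnj y = poly (of_int_poly (h \<circ>\<^sub>p monom 1 ?s)) z"
        by (simp add: cnj_poly cnj_z[symmetric] of_int_hom.map_poly_pcompose poly_pcompose poly_monom)
      then show ?thesis by (simp only: int_adjoin_poly)
    qed
    obtain w where w: "w \<in> int_adjoin z" "X ^ ?s = cnj X + of_nat q * w"
      using int_adjoin_frobenius[OF assms(1), of z f r] by (auto simp: X cnj_poly cnj_z)
    obtain w' where w': "w' \<in> int_adjoin z" "X ^ (?s * ?s) = X + of_nat q * w'"
      using int_adjoin_frobenius[OF assms(1), of z f "r + r"] by (auto simp: X power_add zss)
    obtain n' where n': "n = q * n'" using True by (elim dvdE)
    \<comment> \<open>Multiply \<open>X ^ ?s = cnj X + q * w\<close> by \<open>X\<close> and use
      \<open>X * cnj X = n = q * n'\<close>.\<close>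
    have 1: "X ^ (?s + 1) = of_nat q * (of_int (int n') + w * X)"
      using less.prems(2) by (simp add: w(2) n' algebra_simps)
    have "?s + 1 \<le> ?s * ?s" using s2 mult_le_mono1[OF s2, of ?s] by linarith
    then obtain u where u: "?s * ?s = (?s + 1) + u" using le_Suc_ex by blast
    \<comment> \<open>The quotient of \<open>X = X ^ (?s * ?s) - q * w'\<close> by \<open>q\<close>,
      read off from the factor \<open>q\<close> in \<open>X ^ (?s + 1)\<close>.\<close>
    define X' where "X' = (of_int (int n') + w * X) * X ^ u - w'"
    have X': "X' \<in> int_adjoin z"
      unfolding X'_def using w w' less.prems(1)
      by (intro int_adjoin_diff int_adjoin_mult int_adjoin_add int_adjoin_power int_adjoin_of_int)
    have "X = X ^ (?s * ?s) - of_nat q * w'" using w'(2) by simp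
    also have "X ^ (?s * ?s) = X ^ (?s + 1) * X ^ u" unfolding u by (rule power_add)
    finally have XX': "X = of_nat q * X'" unfolding 1 X'_def by (simp add: algebra_simps)
    \<comment> \<open>\<open>y\<close> equals \<open>n / q ^ 2\<close>, so it is rational, and it
      lies in Z[z]. Hence it is an integer, the smaller norm for the induction.\<close>
    define y where "y = X' * cnj X'"
    have y: "of_nat n = of_nat (q ^ 2) * y"
      using less.prems(2) by (simp add: XX' y_def power2_eq_square mult_ac)
    have "y = of_nat n / of_nat (q ^ 2)" unfolding y using q by simp
    then have "y \<in> \<rat>" by auto
    moreover have "algebraic_int y"
      unfolding y_def using assms(2,4) X'
      by (intro algebraic_int_int_adjoin[of z p] int_adjoin_mult cnj_closed) auto
    ultimately have "y \<in> \<int>" using rational_algebraic_int_is_int by blast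
    then obtain i where i: "y = of_int i" by (elim Ints_cases)
    have "(of_int (int n) :: complex) = of_int (int (q ^ 2) * i)" using y i by simp
    then have ni: "int n = int (q ^ 2) * i" by (simp only: of_int_eq_iff)
    have "0 < int (q ^ 2) * i" using less.prems(3) by (simp only: ni[symmetric] of_nat_0_less_iff)
    then have "i > 0" by (simp add: zero_less_mult_iff)
    define j where "j = nat i"
    have ij: "i = int j" "j > 0" using \<open>i > 0\<close> by (auto simp: j_def)
    then have "int n = int (q ^ 2 * j)" using ni by simp
    then have nj: "n = q ^ 2 * j" by (simp only: of_nat_eq_iff)
    have "1 < q ^ 2" using q by (rule one_less_power) simp
    then have "j < n" using ij(2) unfolding nj by simp
    moreover have "X' * cnj X' = of_nat j" using i ij(1) by (simp add: y_def)
    ultimately have "even (multiplicity q j)" using less.IH X' ij(2) by blast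
    moreover have "multiplicity q n = 2 + multiplicity q j"
      using nj ij(2) assms(1) by (simp add: prime_elem_multiplicity_mult_distrib)
    ultimately show ?thesis by simp
  qed
qed

section \<open>Complex numbers satisfying the character equation\<close>

lemma character_sum_dichotomy:
  fixes X :: "nat \<Rightarrow> complex" and L :: real and m :: nat
  defines "S \<equiv> \<Sum>i\<in>{1..m}. X i"
  assumes "m > 1" "L > 0"
    and eq: "\<And>j. j \<in> {1..m} \<Longrightarrow> (S - X j) * cnj (X j) = - of_real L"
  shows "S = 0 \<or> (\<exists>i\<in>{1..m}. \<exists>j\<in>{1..m}. i \<noteq> j \<and> X i + X j = S)"
proof (rule ccontr)
  assume neg: "\<not> ?thesis"
  then have S: "S \<noteq> 0" by simp
  \<comment> \<open>The constant left after dividing the equation by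
    \<open>S * cnj S\<close>.\<close>
  define M where "M = L / (norm S)\<^sup>2"
  have M: "M > 0" using S assms(3) by (simp add: M_def)
  have ex: "\<exists>r::real. X j = of_real r * S \<and> (1 - r) * r = - M" if j: "j \<in> {1..m}" for j
  proof -
    define a where "a = X j / S"
    have Xj: "X j = a * S" using S by (simp add: a_def)
    have "(1 - a) * cnj a * (S * cnj S) = - of_real L"
      using eq[OF j] by (simp add: Xj algebra_simps)
    then have 1: "(1 - a) * cnj a = - of_real M"
      using S by (simp add: M_def complex_norm_square[symmetric] field_simps)
    \<comment> \<open>The right-hand side is real, which forces \<open>a\<close> to be real.\<close>
    then have "cnj a = a * cnj a - of_real M" by (simp add: algebra_simps)
    then have "cnj a = of_real ((norm a)\<^sup>2 - M)" by (simp add: complex_norm_square[symmetric])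
    then have "a = of_real ((norm a)\<^sup>2 - M)" by (metis complex_cnj_cnj complex_cnj_complex_of_real)
    then obtain r where r: "a = of_real r" by blast
    with 1 have "complex_of_real ((1 - r) * r) = of_real (- M)" by simp
    then have "(1 - r) * r = - M" by (simp only: of_real_eq_iff)
    then show ?thesis using Xj r by auto
  qed
  then obtain r :: "nat \<Rightarrow> real"
    where r: "\<And>j. j \<in> {1..m} \<Longrightarrow> X j = of_real (r j) * S \<and> (1 - r j) * r j = - M"
    by metis
  have same: "r j = r 1" if j: "j \<in> {1..m}" for j
  proof (rule ccontr)
    assume ne: "r j \<noteq> r 1"
    have m1: "1 \<in> {1..m}" using assms(2) by simp
    \<comment> \<open>Two different roots of \<open>(1 - r) * r = - M\<close> have sum 1, giving the
      excluded pair.\<close>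
    have "(r j - r 1) * (1 - (r j + r 1)) = (1 - r j) * r j - (1 - r 1) * r 1"
      by (simp add: algebra_simps)
    also have "\<dots> = 0" using r[OF j] r[OF m1] by simp
    finally have "r j + r 1 = 1" using ne by simp
    moreover have "X j + X 1 = of_real (r j + r 1) * S"
      using r[OF j] r[OF m1] by (simp add: algebra_simps)
    ultimately have "X j + X 1 = S" by simp
    then show False using neg j m1 ne by (metis (full_types))
  qed
  \<comment> \<open>With all ratios equal, each is \<open>1 / m\<close>, strictly between 0 and 1,
    so \<open>(1 - r 1) * r 1\<close> is positive and cannot be \<open>- M\<close>.\<close>
  have "S = (\<Sum>i\<in>{1..m}. X i)" by (simp only: S_def)
  also have "\<dots> = (\<Sum>i\<in>{1..m}. of_real (r 1) * S)"
    using r same by (intro sum.cong refl) metis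
  also have "\<dots> = of_real (real m * r 1) * S" by (simp only: sum_constant) simp
  finally have "of_real (real m * r 1) * S = S" by (rule sym)
  then have "of_real (real m * r 1) * S = of_real 1 * S" by (simp only: of_real_1 mult_1)
  then have "complex_of_real (real m * r 1) = of_real 1" using S by (metis mult_right_cancel)
  then have "real m * r 1 = 1" by (simp only: of_real_eq_iff)
  then have "r 1 = 1 / real m" using assms(2) by (simp add: field_simps)
  then have "0 < r 1" "r 1 < 1" using assms(2) by auto
  then have "(1 - r 1) * r 1 > 0" by simp
  then show False using r[of 1] M assms(2) by simp
qed

section \<open>Homomorphisms of a finite abelian group onto the integers modulo p\<close>

text \<open>A subgroup containing all \<open>p\<close>-th powers and maximal among the proper ones has index \<open>p\<close>; \<open>\<tau>\<close> is the
  quotient map onto the integers modulo \<open>p\<close>.\<close>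
lemma (in comm_group) exists_surj_hom_mod_prime:
  assumes fin: "finite (carrier G)" and p: "prime p" and dvd: "p dvd Coset.order G"
  shows "\<exists>\<tau> :: 'a \<Rightarrow> nat.
    (\<forall>x\<in>carrier G. \<forall>y\<in>carrier G. [\<tau> (x \<otimes> y) = \<tau> x + \<tau> y] (mod p)) \<and>
    (\<exists>a\<in>carrier G. [\<tau> a = 1] (mod p))"
proof -
  define P where "P = (\<lambda>x. x [^] p) ` carrier G"
  have p1: "p > 1" using p by (rule prime_gt_1_nat)
  have P: "subgroup P G"
  proof (rule subgroupI)
    show "P \<subseteq> carrier G" by (auto simp: P_def)
    show "P \<noteq> {}" by (auto simp: P_def)
    show "inv x \<in> P" if "x \<in> P" for x
      using that by (auto simp: P_def nat_pow_inv[symmetric])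
    show "x \<otimes> y \<in> P" if "x \<in> P" "y \<in> P" for x y
      using that by (auto simp: P_def nat_pow_distrib[symmetric])
  qed
  \<comment> \<open>Otherwise the \<open>p\<close>-th power map is onto and, by finiteness,
    injective; but it kills the subgroup of order \<open>p\<close> supplied by Sylow.\<close>
  have "P \<noteq> carrier G"
  proof
    assume eq: "P = carrier G"
    obtain K where K: "subgroup K G" "card K = p ^ 1"
    proof -
      obtain n where "Coset.order G = p ^ 1 * n" using dvd by (auto elim: dvdE)
      then show thesis using sylow_thm[OF p group_axioms _ fin] that by blast
    qed
    have "finite K" using K(1) fin by (meson finite_subset subgroup.subset)
    have "\<not> K \<subseteq> {\<one>}"
      using K(2) p1 card_mono[of "{\<one>}" K] by auto
    then obtain x where x: "x \<in> K" "x \<noteq> \<one>" by blast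
    then have xG: "x \<in> carrier G" using K(1) by (meson subgroup.mem_carrier)
    have "x [^] p = \<one>"
    proof -
      interpret K: group "G\<lparr>carrier := K\<rparr>" using K(1) by (rule subgroup_imp_group)
      have "x [^]\<^bsub>G\<lparr>carrier := K\<rparr>\<^esub> Coset.order (G\<lparr>carrier := K\<rparr>) = \<one>\<^bsub>G\<lparr>carrier := K\<rparr>\<^esub>"
        using x(1) by (intro K.pow_order_eq_1) auto
      then show ?thesis using K(2) by (simp add: Coset.order_def nat_pow_consistent[symmetric])
    qed
    moreover have "inj_on (\<lambda>x. x [^] p) (carrier G)"
      using fin eq by (intro finite_surj_inj) (auto simp: P_def)
    ultimately show False using x(2) xG by (auto dest: inj_onD[of _ _ x \<one>])
  qed
  define F where "F = {H. subgroup H G \<and> P \<subseteq> H \<and> H \<noteq> carrier G}"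
  have "finite F" using fin by (rule finite_subset[rotated, OF finite_Pow_iff[THEN iffD2]])
      (auto simp: F_def dest: subgroup.subset)
  moreover have "F \<noteq> {}" using P \<open>P \<noteq> carrier G\<close> by (auto simp: F_def)
  ultimately obtain H where HF: "H \<in> F" and max: "\<And>K. K \<in> F \<Longrightarrow> H \<subseteq> K \<Longrightarrow> H = K"
    using finite_has_maximal[of F] by metis
  have H: "subgroup H G" and PH: "P \<subseteq> H" and "H \<noteq> carrier G" using HF by (auto simp: F_def)
  interpret H: subgroup H G by (rule H)
  obtain a where a: "a \<in> carrier G" "a \<notin> H" using \<open>H \<noteq> carrier G\<close> H.subset by blast
  have ap: "a [^] (p * t) \<in> H" for t :: nat
  proof -
    have "a [^] (p * t) = (a [^] t) [^] p" using a(1) by (simp add: nat_pow_pow mult.commute)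
    then show ?thesis using PH a(1) by (auto simp: P_def)
  qed
  have aH: "p dvd t" if "a [^] t \<in> H" for t :: nat
  proof (rule ccontr)
    assume "\<not> p dvd t"
    \<comment> \<open>Inverting \<open>t\<close> modulo \<open>p\<close> writes \<open>a\<close> as
      a power of \<open>a [^] t\<close> times the inverse of a \<open>p\<close>-th power, so
      \<open>a\<close> would lie in \<open>H\<close>.\<close>
    then have "coprime t p" using p by (metis coprime_commute prime_imp_coprime)
    then obtain u where "[t * u = 1] (mod p)" using cong_solve_coprime_nat by auto
    then have u: "t * u mod p = 1" using p1 by (simp add: cong_def)
    define v where "v = t * u div p"
    have tu: "t * u = p * v + 1" unfolding v_def using u by (metis mult_div_mod_eq)
    have "a [^] (t * u) \<in> H"
    proof -
      have "(a [^] t) [^] n \<in> H" for n :: nat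
        using that by (induction n) auto
      then show ?thesis using a(1) by (simp add: nat_pow_pow[symmetric])
    qed
    then have 1: "a [^] (p * v) \<otimes> a \<in> H" unfolding tu by simp
    have "a = inv (a [^] (p * v)) \<otimes> (a [^] (p * v) \<otimes> a)"
      using a(1) by (simp add: m_assoc[symmetric])
    also have "\<dots> \<in> H" using 1 ap by blast
    finally show False using a(2) by simp
  qed
  \<comment> \<open>The subgroup generated by \<open>a\<close> and \<open>H\<close>. Natural
    exponents suffice because \<open>a [^] p\<close> lies in \<open>H\<close>; maximality of
    \<open>H\<close> makes \<open>K\<close> the whole group.\<close>
  define K where "K = {x. \<exists>t::nat. \<exists>h\<in>H. x = a [^] t \<otimes> h}"
  have KG: "K \<subseteq> carrier G" using a(1) by (auto simp: K_def)
  have Kmult: "x \<otimes> y \<in> K" if xy: "x \<in> K" "y \<in> K" for x y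
  proof -
    obtain t s :: nat and h h' where *: "h \<in> H" "h' \<in> H" "x = a [^] t \<otimes> h" "y = a [^] s \<otimes> h'"
      using xy unfolding K_def by blast
    then have "x \<otimes> y = a [^] (t + s) \<otimes> (h \<otimes> h')"
      using a(1) by (simp add: nat_pow_mult[symmetric] m_ac)
    then show ?thesis using * by (auto simp: K_def)
  qed
  have Kinv: "inv x \<in> K" if x: "x \<in> K" for x
  proof -
    obtain t :: nat and h where *: "h \<in> H" "x = a [^] t \<otimes> h" using x unfolding K_def by blast
    \<comment> \<open>Chosen so that \<open>t + s\<close> is a multiple of \<open>p\<close>: then
      \<open>a [^] s\<close> inverts \<open>a [^] t\<close> up to an element of
      \<open>H\<close>.\<close>
    define s where "s = (p - 1) * t"
    have st: "t + s = p * t" using p1 by (cases p) (auto simp: s_def)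
    have "inv x = a [^] s \<otimes> (inv (a [^] (p * t)) \<otimes> inv h)"
    proof (rule inv_equality)
      have rearrange: "u \<otimes> (v \<otimes> w) \<otimes> (y \<otimes> h) = (y \<otimes> u) \<otimes> v \<otimes> (w \<otimes> h)"
        if "u \<in> carrier G" "v \<in> carrier G" "w \<in> carrier G" "y \<in> carrier G" for u v w y
        using that *(1) by (simp add: m_ac)
      have "a [^] s \<otimes> (inv (a [^] (p * t)) \<otimes> inv h) \<otimes> x
          = (a [^] t \<otimes> a [^] s) \<otimes> inv (a [^] (p * t)) \<otimes> (inv h \<otimes> h)"
        unfolding *(2) using *(1) a(1) by (intro rearrange) auto
      also have "a [^] t \<otimes> a [^] s = a [^] (p * t)" using a(1) by (simp add: nat_pow_mult st)
      finally show "a [^] s \<otimes> (inv (a [^] (p * t)) \<otimes> inv h) \<otimes> x = \<one>"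
        using * a(1) by simp
    qed (use * a(1) in auto)
    then show ?thesis using ap[of t] * by (auto simp: K_def)
  qed
  have HK: "H \<subseteq> K"
  proof
    fix h assume "h \<in> H"
    then have "h = a [^] (0::nat) \<otimes> h" by simp
    then show "h \<in> K" unfolding K_def using \<open>h \<in> H\<close> by blast
  qed
  have aK: "a \<in> K"
  proof -
    have "a = a [^] (1::nat) \<otimes> \<one>" using a(1) by simp
    then show ?thesis unfolding K_def using H.one_closed by blast
  qed
  have "subgroup K G"
    using KG Kmult Kinv aK by (intro subgroupI) auto
  moreover have "H \<noteq> K" using aK a(2) by blast
  ultimately have "K = carrier G" using max[of K] HK PH by (auto simp: F_def)
  then have "\<exists>t::nat. \<exists>h\<in>H. x = a [^] t \<otimes> h" if "x \<in> carrier G" for x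
    using that by (auto simp: K_def)
  then obtain \<tau> :: "'a \<Rightarrow> nat" where \<tau>: "\<And>x. x \<in> carrier G \<Longrightarrow> \<exists>h\<in>H. x = a [^] \<tau> x \<otimes> h"
    by metis
  \<comment> \<open>The exponent is unique only modulo \<open>p\<close>. Assuming
    \<open>s \<le> t\<close> keeps the subtraction of naturals exact.\<close>
  have le: "[s = t] (mod p)"
    if "s \<le> t" "h \<in> H" "h' \<in> H" "a [^] s \<otimes> h = a [^] t \<otimes> h'" for s t :: nat and h h'
  proof -
    have "a [^] s \<otimes> h = a [^] s \<otimes> (a [^] (t - s) \<otimes> h')"
      using that a(1) by (simp add: m_assoc[symmetric] nat_pow_mult)
    then have "h = a [^] (t - s) \<otimes> h'" using that a(1) by simp
    then have "a [^] (t - s) = h \<otimes> inv h'" using that a(1) by (simp add: m_assoc)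
    then have "a [^] (t - s) \<in> H" using that by simp
    then have "p dvd t - s" by (rule aH)
    then show ?thesis using that(1) by (metis cong_altdef_nat cong_sym)
  qed
  have uniq: "[s = t] (mod p)"
    if "h \<in> H" "h' \<in> H" "a [^] s \<otimes> h = a [^] t \<otimes> h'" for s t :: nat and h h'
    using le[of s t h h'] le[of t s h' h] that by (metis cong_sym nat_le_linear)
  have "[\<tau> (x \<otimes> y) = \<tau> x + \<tau> y] (mod p)" if xy: "x \<in> carrier G" "y \<in> carrier G" for x y
  proof -
    obtain h where h: "h \<in> H" "x = a [^] \<tau> x \<otimes> h" using \<tau> xy by blast
    obtain h' where h': "h' \<in> H" "y = a [^] \<tau> y \<otimes> h'" using \<tau> xy by blast
    obtain h'' where h'': "h'' \<in> H" "x \<otimes> y = a [^] \<tau> (x \<otimes> y) \<otimes> h''" using \<tau> xy by blast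
    have "a [^] \<tau> (x \<otimes> y) \<otimes> h'' = (a [^] \<tau> x \<otimes> h) \<otimes> (a [^] \<tau> y \<otimes> h')"
      using h(2) h'(2) h''(2) by argo
    also have "\<dots> = a [^] (\<tau> x + \<tau> y) \<otimes> (h \<otimes> h')"
      using a(1) h(1) h'(1) by (simp add: nat_pow_mult[symmetric] m_ac)
    finally show ?thesis using h(1) h'(1) h''(1) by (intro uniq[of h'' "h \<otimes> h'"]) auto
  qed
  moreover have "[\<tau> a = 1] (mod p)"
  proof -
    obtain h where "h \<in> H" "a = a [^] \<tau> a \<otimes> h" using \<tau> a(1) by blast
    then show ?thesis using a(1) by (intro uniq[of h \<one>]) auto
  qed
  ultimately show ?thesis using a(1) by blast
qed

section \<open>Counting and character equations of an SEDF\<close>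

lemma sum_mset_image_mset_sum:
  fixes f :: "'a \<Rightarrow> 'b :: comm_monoid_add"
  assumes "finite A"
  shows "sum_mset (image_mset f (\<Sum>i\<in>A. M i)) = (\<Sum>i\<in>A. sum_mset (image_mset f (M i)))"
  using assms by (induction A rule: finite_induct) auto

lemma sum_mset_image_mset_count:
  fixes f :: "'a \<Rightarrow> 'b :: comm_semiring_1"
  assumes "finite S" "set_mset M \<subseteq> S"
  shows "sum_mset (image_mset f M) = (\<Sum>x\<in>S. of_nat (count M x) * f x)"
  using assms(2)
proof (induction M)
  case (add a M)
  have "(\<Sum>x\<in>S. of_nat (count (add_mset a M) x) * f x)
      = (\<Sum>x\<in>S. of_nat (count M x) * f x + (if x = a then f x else 0))"
    by (intro sum.cong) (auto simp: algebra_simps)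
  also have "\<dots> = (\<Sum>x\<in>S. of_nat (count M x) * f x) + f a"
    using add.prems assms(1) by (simp add: sum.distrib)
  finally show ?case using add by (simp add: add.commute)
qed simp

text \<open>Sum \<open>f\<close> over the quotient multiset twice, by pairs and by multiplicities.
  Constant \<open>f\<close> yields the counting identity, a character the equation for the
  \<open>X j\<close>.\<close>

lemma is_SEDF_sum_quotients:
  fixes G (structure) and f :: "'a \<Rightarrow> 'c :: comm_ring_1"
  assumes D: "is_SEDF G v m k lam D" and j: "j \<in> {1..m}"
  shows "(\<Sum>i\<in>{1..m} - {j}. \<Sum>x\<in>D i. \<Sum>y\<in>D j. f (x \<otimes> inv y))
    = of_nat lam * ((\<Sum>g\<in>carrier G. f g) - f \<one>)"
proof -
  interpret comm_group G using D by (simp add: is_SEDF_def)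
  let ?Q = "sedf_quotients G m D j"
  have fin: "finite (carrier G)" and sub: "\<And>i. i \<in> {1..m} \<Longrightarrow> D i \<subseteq> carrier G"
    and count: "\<And>g. g \<in> carrier G - {\<one>} \<Longrightarrow> count ?Q g = lam" and one: "\<one> \<notin># ?Q"
    using D j by (auto simp: is_SEDF_def)
  have finD: "finite (D i)" if "i \<in> {1..m}" for i using sub[OF that] fin by (rule finite_subset)
  have "sum_mset (image_mset f ?Q)
      = (\<Sum>i\<in>{1..m} - {j}. \<Sum>z\<in>D i \<times> D j. f (fst z \<otimes> inv (snd z)))"
    unfolding sedf_quotients_def
    by (subst sum_mset_image_mset_sum, simp, intro sum.cong refl)
      (simp add: sum_unfold_sum_mset image_mset.compositionality o_def case_prod_beta)
  also have "\<dots> = (\<Sum>i\<in>{1..m} - {j}. \<Sum>x\<in>D i. \<Sum>y\<in>D j. f (x \<otimes> inv y))"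
    by (intro sum.cong refl) (simp add: sum.cartesian_product case_prod_beta)
  finally have "(\<Sum>i\<in>{1..m} - {j}. \<Sum>x\<in>D i. \<Sum>y\<in>D j. f (x \<otimes> inv y)) = sum_mset (image_mset f ?Q)"
    by simp
  also have "\<dots> = (\<Sum>g\<in>carrier G - {\<one>}. of_nat (count ?Q g) * f g)"
  proof (rule sum_mset_image_mset_count)
    show "set_mset ?Q \<subseteq> carrier G - {\<one>}"
    proof
      fix g assume g: "g \<in># ?Q"
      then have "g \<in> (\<Union>i\<in>{1..m} - {j}.
          set_mset (image_mset (\<lambda>(x, y). x \<otimes> inv y) (mset_set (D i \<times> D j))))"
        unfolding sedf_quotients_def by (simp only: set_mset_sum finite_Diff finite_atLeastAtMost)
      then obtain i where i: "i \<in> {1..m} - {j}"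
        "g \<in># image_mset (\<lambda>(x, y). x \<otimes> inv y) (mset_set (D i \<times> D j))" by blast
      then obtain x y where "x \<in> D i" "y \<in> D j" "g = x \<otimes> inv y"
        using finD j by auto
      then have "g \<in> carrier G" using sub[of i] sub[of j] i j by auto
      then show "g \<in> carrier G - {\<one>}" using g one by auto
    qed
  qed (use fin in simp)
  also have "\<dots> = of_nat lam * (\<Sum>g\<in>carrier G - {\<one>}. f g)"
    using count by (simp add: sum_distrib_left)
  also have "(\<Sum>g\<in>carrier G - {\<one>}. f g) = (\<Sum>g\<in>carrier G. f g) - f \<one>"
    using fin by (simp add: sum_diff1)
  finally show ?thesis .
qed

lemma is_SEDF_count:
  assumes D: "is_SEDF G v m k lam D" and m: "m > 0"
  shows "lam * (v - 1) = (m - 1) * k\<^sup>2"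
proof -
  interpret comm_group G using D by (simp add: is_SEDF_def)
  have fin: "finite (carrier G)" and v: "card (carrier G) = v"
    and card: "\<And>i. i \<in> {1..m} \<Longrightarrow> card (D i) = k"
    using D by (auto simp: is_SEDF_def Coset.order_def)
  have "v > 0" using fin v one_closed card_gt_0_iff by blast
  have "(\<Sum>i\<in>{1..m} - {1}. \<Sum>x\<in>D i. \<Sum>y\<in>D 1. 1) = int lam * ((\<Sum>g\<in>carrier G. 1) - 1)"
    using is_SEDF_sum_quotients[OF D, of 1 "\<lambda>_. 1 :: int"] m by simp
  also have "(\<Sum>i\<in>{1..m} - {1}. \<Sum>x\<in>D i. \<Sum>y\<in>D 1. (1::int)) = (\<Sum>i\<in>{1..m} - {1}. int (k * k))"
    using card m by (intro sum.cong) auto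
  also have "\<dots> = int ((m - 1) * k\<^sup>2)" using m by (simp add: power2_eq_square card_Diff_singleton)
  also have "int lam * ((\<Sum>g\<in>carrier G. 1) - 1) = int (lam * (v - 1))"
    using v \<open>v > 0\<close> by (simp add: of_nat_diff)
  finally show ?thesis by (simp only: of_nat_eq_iff)
qed

lemma is_SEDF_even_multiplicity:
  fixes G (structure)
  assumes D: "is_SEDF G v m k lam D" and m: "m > 2" and lam: "lam > 0"
    and p: "prime p" "p > 2" "p dvd v" and q: "prime q" "self_conjugate_mod q p"
    and ndvd: "\<not> p dvd (m - 2) * k"
  shows "even (multiplicity q lam)"
proof -
  interpret comm_group G using D by (simp add: is_SEDF_def)
  have fin: "finite (carrier G)" and v: "Coset.order G = v"
    and sub: "\<And>i. i \<in> {1..m} \<Longrightarrow> D i \<subseteq> carrier G"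
    and card: "\<And>i. i \<in> {1..m} \<Longrightarrow> card (D i) = k"
    using D by (auto simp: is_SEDF_def)
  obtain \<tau> a where \<tau>: "\<And>x y. x \<in> carrier G \<Longrightarrow> y \<in> carrier G \<Longrightarrow> [\<tau> (x \<otimes> y) = \<tau> x + \<tau> y] (mod p)"
    and a: "a \<in> carrier G" "[\<tau> a = 1] (mod p)"
    using exists_surj_hom_mod_prime[OF fin p(1)] p(3) v by metis
  define z where "z = cis (2 * pi / real p)"
  have zp: "z ^ p = 1" and norm_z: "norm z = 1"
    using p(2) by (auto simp: z_def DeMoivre)
  have z1: "z \<noteq> 1"
  proof
    assume "z = 1"
    then have "cos (2 * pi / real p) = 1" by (simp add: z_def complex_eq_iff)
    moreover have "cos (2 * pi / real p) < cos 0"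
      using p(2) by (intro cos_monotone_0_pi) (auto simp: field_simps)
    ultimately show False by simp
  qed
  \<comment> \<open>This turns \<open>\<tau>\<close>, additive only modulo \<open>p\<close>, into a
    genuine character.\<close>
  have zmod: "z ^ s = z ^ t" if "[s = t] (mod p)" for s t
  proof -
    have "z ^ u = z ^ (u mod p)" for u
    proof -
      have "z ^ u = z ^ (p * (u div p) + u mod p)" by simp
      also have "\<dots> = z ^ (u mod p)" by (simp only: power_add power_mult zp power_one mult_1)
      finally show ?thesis .
    qed
    then show ?thesis using that by (metis cong_def)
  qed
  define \<chi> where "\<chi> x = z ^ \<tau> x" for x
  have hom: "\<chi> (x \<otimes> y) = \<chi> x * \<chi> y" if "x \<in> carrier G" "y \<in> carrier G" for x y
    using zmod[OF \<tau>[OF that]] by (simp add: \<chi>_def power_add)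
  have norm: "\<chi> x * cnj (\<chi> x) = 1" for x
  proof -
    have "norm (\<chi> x) = 1" by (simp add: \<chi>_def norm_power norm_z)
    then show ?thesis by (simp only: complex_norm_square[symmetric]) simp
  qed
  have \<chi>_nz: "\<chi> x \<noteq> 0" for x using norm[of x] by auto
  have one: "\<chi> \<one> = 1" using hom[of \<one> \<one>] \<chi>_nz[of \<one>] by simp
  have quot: "\<chi> (x \<otimes> inv y) = \<chi> x * cnj (\<chi> y)" if "x \<in> carrier G" "y \<in> carrier G" for x y
  proof -
    have "\<chi> y * \<chi> (inv y) = \<chi> y * cnj (\<chi> y)"
      using hom[of y "inv y"] that by (simp add: one norm)
    then have "\<chi> (inv y) = cnj (\<chi> y)" using \<chi>_nz[of y] by simp
    then show ?thesis using hom[of x "inv y"] that by simp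
  qed
  \<comment> \<open>Translation by \<open>a\<close> permutes the group and multiplies the sum by
    \<open>\<chi> a = z\<close>, which is not 1.\<close>
  have sum0: "(\<Sum>g\<in>carrier G. \<chi> g) = 0"
  proof -
    have "(\<Sum>g\<in>carrier G. \<chi> (a \<otimes> g)) = (\<Sum>g\<in>carrier G. \<chi> g)"
      using a(1) by (intro sum.reindex_bij_betw)
        (auto simp: bij_betw_def inj_on_multc inj_on_cmult surj_const_mult)
    then have "\<chi> a * (\<Sum>g\<in>carrier G. \<chi> g) = (\<Sum>g\<in>carrier G. \<chi> g)"
      using a(1) by (simp add: hom sum_distrib_left)
    moreover have "\<chi> a \<noteq> 1" using zmod[OF a(2)] z1 by (simp add: \<chi>_def)
    ultimately show ?thesis by simp
  qed
  \<comment> \<open>A lift of \<open>X i\<close> to a polynomial: its value at \<open>z\<close> is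
    \<open>X i\<close>, its value at 1 is \<open>k\<close>.\<close>
  define F :: "nat \<Rightarrow> int poly" where "F i = (\<Sum>x\<in>D i. monom 1 (\<tau> x))" for i
  define X where "X i = (\<Sum>x\<in>D i. \<chi> x)" for i
  define S where "S = (\<Sum>i\<in>{1..m}. X i)"
  have XF: "X i = poly (of_int_poly (F i)) z" for i
    by (simp add: X_def F_def \<chi>_def hom_distribs poly_sum poly_monom)
  have F1: "poly (F i) 1 = int k" if "i \<in> {1..m}" for i
    using card[OF that] by (simp add: F_def poly_sum poly_monom)
  have eq: "(S - X j) * cnj (X j) = - of_real (real lam)" if j: "j \<in> {1..m}" for j
  proof -
    have "(S - X j) * cnj (X j) = (\<Sum>i\<in>{1..m} - {j}. X i * cnj (X j))"
      using j by (simp add: S_def sum_diff1 left_diff_distrib sum_distrib_right[of X])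
    also have "\<dots> = (\<Sum>i\<in>{1..m} - {j}. \<Sum>x\<in>D i. \<Sum>y\<in>D j. \<chi> x * cnj (\<chi> y))"
      by (simp add: X_def sum_product)
    also have "\<dots> = (\<Sum>i\<in>{1..m} - {j}. \<Sum>x\<in>D i. \<Sum>y\<in>D j. \<chi> (x \<otimes> inv y))"
      using sub j by (intro sum.cong refl) (auto intro!: quot[symmetric])
    also have "\<dots> = of_nat lam * (0 - 1)"
      by (simp only: is_SEDF_sum_quotients[OF D j] sum0 one)
    finally show ?thesis by simp
  qed
  have "S = 0"
  proof (rule ccontr)
    assume "S \<noteq> 0"
    then obtain i j where ij: "i \<in> {1..m}" "j \<in> {1..m}" "X i + X j = S"
      using character_sum_dichotomy[of m "real lam" X] eq lam m unfolding S_def by auto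
    \<comment> \<open>\<open>?H\<close> vanishes at \<open>z\<close> and takes the value
      \<open>(m - 2) * k\<close> at 1.\<close>
    let ?H = "(\<Sum>i\<in>{1..m}. F i) - (F i + F j)"
    have "poly (of_int_poly ?H) z = S - (X i + X j)"
      by (simp add: S_def XF hom_distribs poly_sum)
    then have "int p dvd poly ?H 1"
      using ij(3) by (intro prime_dvd_poly_1_if_root_of_unity_root[OF p(1) zp]) simp
    also have "poly ?H 1 = int ((m - 2) * k)"
      using ij F1 m by (simp add: poly_sum algebra_simps of_nat_diff)
    finally have "p dvd (m - 2) * k" by (simp only: int_dvd_int_iff)
    with ndvd show False ..
  qed
  then have "X 1 * cnj (X 1) = of_nat lam" using eq[of 1] m by simp
  moreover have "X 1 \<in> int_adjoin z" unfolding XF by (rule int_adjoin_poly)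
  ultimately show ?thesis
    using even_multiplicity_norm_self_conjugate[OF q(1) p(2) q(2) zp norm_z] lam by blast
qed

section \<open>Parity of the exponent of q\<close>

text \<open>In \<open>lam * n = (m - 1) * k\<^sup>2\<close> the square contributes an even exponent
  of \<open>q\<close>, so the assumed parity makes the exponent in \<open>lam\<close> odd. Both
  cases of the theorem reduce to this.\<close>

lemma not_is_SEDF_if_odd_multiplicity:
  assumes m: "m > 2" and n: "n > 0" and p: "prime p" "p > 2" "p dvd n + 1"
    and q: "prime q" "self_conjugate_mod q p" and ndvd: "\<not> p dvd (m - 2) * k"
    and odd: "odd (multiplicity q (m - 1) + multiplicity q n)"
  shows "\<not> is_SEDF G (n + 1) m k lam D"
proof
  assume D: "is_SEDF G (n + 1) m k lam D"
  \<comment> \<open>The definition of an SEDF allows \<open>k = 0\<close>, but then \<open>p\<close>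
    would divide \<open>(m - 2) * k\<close>.\<close>
  have k: "k > 0" using ndvd by (auto intro: Nat.gr0I)
  have eq: "lam * n = (m - 1) * k\<^sup>2" using is_SEDF_count[OF D] m by simp
  also have "\<dots> > 0" using m k by simp
  finally have lam: "lam > 0" by (auto intro: Nat.gr0I)
  have "multiplicity q lam + multiplicity q n = multiplicity q (lam * n)"
    using q(1) lam n by (simp add: prime_elem_multiplicity_mult_distrib)
  also have "\<dots> = multiplicity q (m - 1) + 2 * multiplicity q k"
    unfolding eq using q(1) m k
    by (simp add: prime_elem_multiplicity_mult_distrib prime_elem_multiplicity_power_distrib)
  finally have "odd (multiplicity q lam)" using odd by presburger
  then show False using is_SEDF_even_multiplicity[OF D m lam p q ndvd] by simp
qed

lemma multiplicity_prime_power_times_square: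
  fixes q l :: nat
  assumes "prime q" "l > 0"
  shows "multiplicity q (q ^ a * l\<^sup>2) = a + 2 * multiplicity q l"
  using assms
  by (simp add: prime_elem_multiplicity_mult_distrib prime_elem_multiplicity_power_distrib
      multiplicity_same_power prime_gt_0_nat)

lemma exactly_divides_multiplicity: "exactly_divides q a n \<Longrightarrow> multiplicity q n = a"
  by (intro multiplicity_eqI) (auto simp: exactly_divides_def)

theorem theorem4p7:
  fixes l m b c :: nat
    and G :: "('a, 'b) monoid_scheme"
  assumes "l > 2" and "m > 2" and "b > 0" and "c > 0"
  shows
    "(\<forall>p q k lam :: nat.
        prime p \<and> p > 2 \<and> prime q \<and> p \<noteq> q \<and>
        p dvd q ^ (2 * b) * l ^ 2 + 1 \<and>
        exactly_divides q (2 * c + 1) (m - 1) \<and>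
        self_conjugate_mod q p \<and>
        \<not> p dvd (m - 2) * k
        \<longrightarrow> \<not> (\<exists>D. is_SEDF G (q ^ (2 * b) * l ^ 2 + 1) m k lam D)) \<and>
     (\<forall>p q k lam :: nat.
        prime q \<and>
        (exactly_divides q (2 * c) (m - 1) \<or> \<not> q dvd m - 1) \<and>
        prime p \<and> odd p \<and>
        p dvd q ^ (2 * b + 1) * l ^ 2 + 1 \<and>
        self_conjugate_mod q p \<and>
        \<not> p dvd (m - 2) * k
        \<longrightarrow> \<not> (\<exists>D. is_SEDF G (q ^ (2 * b + 1) * l ^ 2 + 1) m k lam D))"
proof (intro conjI allI impI; elim conjE; intro notI; elim exE)
  fix p q k lam :: nat and D
  assume p: "prime p" "p > 2" "p dvd q ^ (2 * b) * l ^ 2 + 1"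
    and q: "prime q" "self_conjugate_mod q p" and ndvd: "\<not> p dvd (m - 2) * k"
    and ex: "exactly_divides q (2 * c + 1) (m - 1)"
    and D: "is_SEDF G (q ^ (2 * b) * l ^ 2 + 1) m k lam D"
  have "q ^ (2 * b) * l ^ 2 > 0" using prime_gt_0_nat[OF q(1)] assms(1) by simp
  \<comment> \<open>The exponents are \<open>2 * c + 1\<close> and \<open>2 * b\<close> plus an even
    number from the square.\<close>
  moreover have "odd (multiplicity q (m - 1) + multiplicity q (q ^ (2 * b) * l ^ 2))"
    using assms(1) exactly_divides_multiplicity[OF ex]
    by (subst multiplicity_prime_power_times_square[OF q(1)]) auto
  ultimately show False
    using not_is_SEDF_if_odd_multiplicity[OF assms(2) _ p q ndvd] D by blast
next
  fix p q k lam :: nat and D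
  assume p: "prime p" "odd p" "p dvd q ^ (2 * b + 1) * l ^ 2 + 1"
    and q: "prime q" "self_conjugate_mod q p" and ndvd: "\<not> p dvd (m - 2) * k"
    and ex: "exactly_divides q (2 * c) (m - 1) \<or> \<not> q dvd m - 1"
    and D: "is_SEDF G (q ^ (2 * b + 1) * l ^ 2 + 1) m k lam D"
  have "p > 2" using p(1,2) prime_ge_2_nat[of p] by (cases "p = 2") auto
  have "q ^ (2 * b + 1) * l ^ 2 > 0" using prime_gt_0_nat[OF q(1)] assms(1) by simp
  \<comment> \<open>The exponent is \<open>2 * c\<close> or 0; the odd contribution now comes from
    \<open>q ^ (2 * b + 1)\<close>.\<close>
  moreover have "even (multiplicity q (m - 1))"
    using ex by (auto simp: exactly_divides_multiplicity not_dvd_imp_multiplicity_0)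
  then have "odd (multiplicity q (m - 1) + multiplicity q (q ^ (2 * b + 1) * l ^ 2))"
    using assms(1) by (subst multiplicity_prime_power_times_square[OF q(1)]) auto
  ultimately show False
    using not_is_SEDF_if_odd_multiplicity[OF assms(2) _ p(1) \<open>p > 2\<close> p(3) q ndvd] D by blast
qed

end
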